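(* Let $v_1, v_2, \dots, v_n$ be real numbers such that $\sum_{i=1}^n v_i^2 \le 1$. Let $a_1, a_2, \dots, a_n$ be independent random signs, and let $S = \sum_{i=1}^n a_i v_i$. Then \[ \Pr[\,|S| \le 1\,] > \frac{13}{32} + 9 \times 10^{-6}. \]
   Context: A random sign is a random variable uniformly distributed on $\{-1,+1\}$. *)

theory Defs
  imports "HOL-Probability.Probability"
begin

text \<open>
  The law of \<open>X\<close> is compared on the Borel sets, so \<open>X\<close> may take values outside
  \<open>{-1, 1}\<close> on a null set.
\<close>

definition random_sign :: "'a measure \<Rightarrow> ('a \<Rightarrow> real) \<Rightarrow> bool" where
  "random_sign M X \<longleftrightarrow>
     X \<in> borel_measurable M \<and>
     distr M borel X = distr (measure_pmf (pmf_of_set {-1, 1})) borel (\<lambda>x. x)"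

end

theory Submission imports Defs begin

text \<open>
  Write \<open>Y\<close> for a signed sum of variance \<open>R\<close>. Two facts drive the argument. First, if \<open>\<bar>x\<bar> \<le> 1\<close>, then
  \<open>\<bar>Y\<bar> \<le> 1 + \<bar>x\<bar>\<close> together with the event that \<open>Y\<close> and \<open>x\<close> have opposite signs forces
  \<open>\<bar>x + Y\<bar> \<le> 1\<close>; so the probability of \<open>\<bar>x + Y\<bar> \<le> 1\<close> is at least half that of
  \<open>\<bar>Y\<bar> \<le> 1 + \<bar>x\<bar>\<close>. Second, \<open>E Y\<^sup>4 \<le> 3 R\<^sup>2\<close>, so Cantelli's inequality for \<open>Y\<^sup>2\<close> gives
  \<open>Pr[\<bar>Y\<bar> > t] \<le> 2 / (2 + (r - 1)\<^sup>2)\<close> when \<open>r R \<le> t\<^sup>2\<close>. Together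
  (\<open>sign_avg_ge_stay_bound\<close>): if \<open>r R \<le> (1 + \<bar>x\<bar>)\<^sup>2\<close>, then \<open>x + Y\<close> stays in \<open>[-1, 1]\<close> with
  probability at least \<open>stay_bound r\<close>. At \<open>r = 4\<close> this is \<open>9/22 = 0.409...\<close>, already more than
  \<open>13/32 = 0.40625\<close>, whereas Chebyshev's inequality would give \<open>3/8\<close>.

  It remains to reveal signs one at a time until the ratio of \<open>(1 + \<bar>x\<bar>)\<^sup>2\<close> to the remaining variance is
  about \<open>4\<close> while the partial sum \<open>x\<close> is still in \<open>[-1, 1]\<close>. The coefficients are taken nonnegative and in
  decreasing order, and the walk stops as soon as the next step \<open>w\<close> could leave \<open>[-1, 1]\<close>, that is, when
  \<open>\<bar>x\<bar> + w > 1\<close>. If not all signs revealed so far agree, then the coefficients used have sum at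
  least \<open>\<bar>x\<bar> + 2 w > 1 + w\<close>, and as each is at least \<open>w\<close> their squares add up to at least \<open>w + w\<^sup>2\<close>;
  the remaining variance is then at most \<open>1 - w - w\<^sup>2 \<le> (2 - w)\<^sup>2 / 4 \<le> (1 + \<bar>x\<bar>)\<^sup>2 / 4\<close>
  (\<open>stopping_after_turn\<close>). Only the branch in which the first \<open>k\<close> signs all agree can miss the ratio \<open>4\<close>,
  where \<open>k\<close> is maximal such that the \<open>k\<close> largest coefficients have sum at most \<open>1\<close>. This branch has
  probability \<open>2^(1-k)\<close> and misses the ratio by little. For \<open>k \<ge> 4\<close> the loss is affordable; for
  \<open>k = 2\<close> and \<open>k = 3\<close> the other branches have a ratio exceeding \<open>4\<close> that compensates
  (\<open>sorted_bound\<close>).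

  For \<open>k = 1\<close> the two largest coefficients satisfy \<open>a + b > 1\<close> (\<open>two_large_coefficients\<close>). Here the step
  \<open>b\<close> is reserved for the end: a walk that never stops is still in \<open>[-1, 1]\<close> before the last step, and one of
  the two signs of \<open>b\<close> keeps it there. This succeeds unless \<open>a < 3/5\<close> and the third coefficient \<open>c\<close> exceeds
  \<open>1 - a\<close>. In that case, if \<open>b + c \<le> 1\<close>, reserving both \<open>b\<close> and \<open>c\<close> and using only the second moment is
  enough; and if \<open>b + c > 1\<close>, the remaining coefficients have standard deviation at most \<open>1 - a\<close>, and the bound
  being proved, applied to these fewer coefficients after rescaling, is more than enough.
\<close>

section \<open>Averages over signs\<close>

text \<open>
  This is the expectation of \<open>f (x + S)\<close>, where \<open>S\<close> is the randomly signed sum of the list. Keeping the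
  starting point \<open>x\<close> as an argument turns revealing a sign into unfolding the recursion, so that stopping-time
  arguments become inductions on the list.
\<close>

primrec sign_avg :: "(real \<Rightarrow> real) \<Rightarrow> real list \<Rightarrow> real \<Rightarrow> real" where
  "sign_avg f [] x = f x"
| "sign_avg f (v # vs) x = (sign_avg f vs (x + v) + sign_avg f vs (x - v)) / 2"

abbreviation sumsq :: "real list \<Rightarrow> real" where
  "sumsq vs \<equiv> (\<Sum>v\<leftarrow>vs. v\<^sup>2)"

definition unit_ind :: "real \<Rightarrow> real" where
  "unit_ind x = of_bool (\<bar>x\<bar> \<le> 1)"

lemma sumsq_nonneg: "0 \<le> sumsq vs"
  by (induction vs) auto

lemma sign_avg_append: "sign_avg f (us @ vs) x = sign_avg (sign_avg f vs) us x"
  by (induction us arbitrary: x) auto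

lemma sign_avg_mono: "(\<And>y. f y \<le> g y) \<Longrightarrow> sign_avg f vs x \<le> sign_avg g vs x"
  by (induction vs arbitrary: x) (auto intro!: divide_right_mono add_mono)

lemma sign_avg_of_bool_nonneg: "0 \<le> sign_avg (\<lambda>y. of_bool (P y)) vs x"
  by (induction vs arbitrary: x) auto

lemma sign_avg_const: "sign_avg (\<lambda>_. c) vs x = c"
  by (induction vs arbitrary: x) auto

lemma sign_avg_add: "sign_avg (\<lambda>y. f y + g y) vs x = sign_avg f vs x + sign_avg g vs x"
  by (induction vs arbitrary: x) (auto simp: field_simps)

lemma sign_avg_cmult: "sign_avg (\<lambda>y. c * f y) vs x = c * sign_avg f vs x"
  by (induction vs arbitrary: x) (auto simp: field_simps)

lemma sign_avg_shift: "sign_avg (\<lambda>y. f (x + y)) vs z = sign_avg f vs (x + z)"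
  by (induction vs arbitrary: z) (auto simp: algebra_simps)

lemma sign_avg_reflect: "sign_avg (\<lambda>y. f (- y)) vs x = sign_avg f vs (- x)"
proof (induction vs arbitrary: x)
  case (Cons v vs)
  have "- (x + v) = - x - v" "- (x - v) = - x + v"
    by auto
  then show ?case
    by (simp only: sign_avg.simps Cons.IH add.commute)
qed simp

lemma sign_avg_move: "sign_avg f (us @ v # vs) x = sign_avg f (v # us @ vs) x"
proof (induction us arbitrary: x)
  case (Cons u us)
  show ?case
    by (simp only: append_Cons sign_avg.simps Cons.IH) (simp add: algebra_simps add_divide_distrib)
qed simp

text \<open>Reordering the steps is what allows sorting them and moving chosen steps to the end.\<close>

lemma sign_avg_perm:
  "mset us = mset vs \<Longrightarrow> sign_avg f us x = sign_avg f vs x"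
proof (induction us arbitrary: vs x)
  case (Cons u us)
  then have "u \<in> set vs"
    by (metis list.set_intros(1) mset_eq_setD)
  then obtain as bs where vs: "vs = as @ u # bs"
    by (meson split_list)
  with Cons.prems have "mset us = mset (as @ bs)"
    by simp
  then have "sign_avg f us y = sign_avg f (as @ bs) y" for y
    by (rule Cons.IH)
  then show ?case
    unfolding vs sign_avg_move by simp
qed simp

lemma sign_avg_abs: "sign_avg f (map abs vs) x = sign_avg f vs x"
  by (induction vs arbitrary: x) (auto simp: abs_if)

lemma sign_avg_replicate_zero: "sign_avg f (vs @ replicate k 0) x = sign_avg f vs x"
proof -
  have "sign_avg f (replicate k 0) = f"
    by (induction k) (auto simp: fun_eq_iff)
  then show ?thesis
    by (simp add: sign_avg_append)
qed

lemma sign_avg_square: "sign_avg (\<lambda>y. y\<^sup>2) vs x = x\<^sup>2 + sumsq vs"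
  by (induction vs arbitrary: x) (auto simp: field_simps power2_eq_square)

lemma sign_avg_fourth: "sign_avg (\<lambda>y. y ^ 4) vs x \<le> x ^ 4 + 6 * x\<^sup>2 * sumsq vs + 3 * (sumsq vs)\<^sup>2"
proof (induction vs arbitrary: x)
  case (Cons v vs)
  define R where "R = sumsq vs"
  have "sign_avg (\<lambda>y. y ^ 4) (v # vs) x
      \<le> ((x + v) ^ 4 + 6 * (x + v)\<^sup>2 * R + 3 * R\<^sup>2 + ((x - v) ^ 4 + 6 * (x - v)\<^sup>2 * R + 3 * R\<^sup>2)) / 2"
    using Cons[of "x + v"] Cons[of "x - v"] by (simp add: R_def)
  also have "\<dots> = x ^ 4 + 6 * x\<^sup>2 * (v\<^sup>2 + R) + 3 * (v\<^sup>2 + R)\<^sup>2 - 2 * v ^ 4"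
    by (simp add: field_simps power2_eq_square power4_eq_xxxx)
  also have "\<dots> \<le> x ^ 4 + 6 * x\<^sup>2 * (v\<^sup>2 + R) + 3 * (v\<^sup>2 + R)\<^sup>2"
    by simp
  finally show ?case
    by (simp add: R_def)
qed simp

section \<open>The probability of staying in the interval\<close>

lemma sign_avg_unit_even: "sign_avg unit_ind vs (- x) = sign_avg unit_ind vs x"
proof -
  have "(\<lambda>y. unit_ind (- y)) = unit_ind"
    by (simp add: unit_ind_def fun_eq_iff)
  then show ?thesis
    using sign_avg_reflect[of unit_ind vs x] by simp
qed

text \<open>
  Half of \<open>1 - 2 / (2 + (r - 1)\<^sup>2)\<close>: the subtracted fraction is Cantelli's bound for a variable with mean
  \<open>1\<close> and variance at most \<open>2\<close> reaching \<open>r\<close>, and the half comes from the reflection of \<open>Y\<close>.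
\<close>

definition stay_bound :: "real \<Rightarrow> real" where
  "stay_bound r = 1 / 2 - 1 / (2 + (r - 1)\<^sup>2)"

lemma stay_bound_le_half: "stay_bound r \<le> 1 / 2"
  by (simp add: stay_bound_def)

text \<open>
  Cantelli's inequality for \<open>Y\<^sup>2\<close>, which has mean \<open>R\<close> and variance at most \<open>2 R\<^sup>2\<close>. The test function
  \<open>h\<close> is the square of an affine function of \<open>Y\<^sup>2\<close>, normalised to be \<open>1\<close> at \<open>Y\<^sup>2 = r R\<close>; the affine
  function is the one that minimises the expectation of \<open>h\<close> when the variance is \<open>2 R\<^sup>2\<close>.
\<close>

lemma sign_avg_tail_bound:
  fixes t :: real
  assumes r: "1 \<le> r" and t: "0 \<le> t" "r * sumsq vs \<le> t\<^sup>2"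
  shows "2 * stay_bound r \<le> sign_avg (\<lambda>y. of_bool (\<bar>y\<bar> \<le> t)) vs 0"
proof (cases "sumsq vs = 0")
  case True
  have zero: "\<forall>v\<in>set vs. v = 0"
    using True by (subst (asm) sum_list_nonneg_eq_0_iff) auto
  then have "sign_avg f vs x = f x" for f x
    by (induction vs arbitrary: x) auto
  then show ?thesis
    using t stay_bound_le_half[of r] by simp
next
  case False
  define R where "R = sumsq vs"
  have R: "R > 0"
    using False sumsq_nonneg[of vs] by (simp add: R_def)
  define D where "D = 2 + (r - 1)\<^sup>2"
  have D: "D > 0"
    unfolding D_def by (simp add: add_pos_nonneg)
  define h where "h y = ((r - 1) * (y\<^sup>2 - R) + 2 * R)\<^sup>2 / (D * R)\<^sup>2" for y
  have *: "1 - h y \<le> of_bool (\<bar>y\<bar> \<le> t)" for y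
  proof (cases "\<bar>y\<bar> \<le> t")
    case False
    then have "t\<^sup>2 \<le> y\<^sup>2"
      using t(1) power_mono[of t "\<bar>y\<bar>" 2] by simp
    then have "r * R \<le> y\<^sup>2"
      using t(2) by (simp add: R_def)
    then have "(r - 1) * (r * R - R) + 2 * R \<le> (r - 1) * (y\<^sup>2 - R) + 2 * R"
      using r by (intro add_mono mult_left_mono) auto
    moreover have "(r - 1) * (r * R - R) + 2 * R = D * R"
      by (simp add: D_def algebra_simps power2_eq_square)
    ultimately have "(D * R)\<^sup>2 \<le> ((r - 1) * (y\<^sup>2 - R) + 2 * R)\<^sup>2"
      using D R by (intro power_mono) auto
    then show ?thesis
      using False D R by (simp add: h_def le_divide_eq)
  qed (simp add: h_def)
  have h: "1 - h y = (1 - ((3 - r) * R)\<^sup>2 / (D * R)\<^sup>2)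
      + ((- (2 * (r - 1) * (3 - r) * R) / (D * R)\<^sup>2) * y\<^sup>2 + (- (r - 1)\<^sup>2 / (D * R)\<^sup>2) * y ^ 4)" for y
    using D R by (simp add: h_def field_simps power2_eq_square power4_eq_xxxx)
  have "(r - 1)\<^sup>2 / (D * R)\<^sup>2 * sign_avg (\<lambda>y. y ^ 4) vs 0 \<le> (r - 1)\<^sup>2 / (D * R)\<^sup>2 * (3 * R\<^sup>2)"
    using sign_avg_fourth[of vs 0] by (intro mult_left_mono) (auto simp: R_def)
  then have "(1 - ((3 - r) * R)\<^sup>2 / (D * R)\<^sup>2) + ((- (2 * (r - 1) * (3 - r) * R) / (D * R)\<^sup>2) * R
        + (- (r - 1)\<^sup>2 / (D * R)\<^sup>2) * (3 * R\<^sup>2)) \<le> sign_avg (\<lambda>y. 1 - h y) vs 0"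
    unfolding h sign_avg_add sign_avg_const sign_avg_cmult sign_avg_square
    by (simp add: R_def)
  moreover have "(1 - ((3 - r) * R)\<^sup>2 / (D * R)\<^sup>2) + ((- (2 * (r - 1) * (3 - r) * R) / (D * R)\<^sup>2) * R
        + (- (r - 1)\<^sup>2 / (D * R)\<^sup>2) * (3 * R\<^sup>2))
      = 1 - (((3 - r) * R)\<^sup>2 + 2 * (r - 1) * (3 - r) * R * R + (r - 1)\<^sup>2 * (3 * R\<^sup>2)) / (D * R)\<^sup>2"
    by (simp add: add_divide_distrib)
  moreover have "((3 - r) * R)\<^sup>2 + 2 * (r - 1) * (3 - r) * R * R + (r - 1)\<^sup>2 * (3 * R\<^sup>2) = 2 * D * R\<^sup>2"
    by (simp add: D_def power2_eq_square algebra_simps)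
  moreover have "(2 * D * R\<^sup>2) / (D * R)\<^sup>2 = 2 / D"
    using D R by (simp add: field_simps power2_eq_square)
  ultimately have "1 - 2 / D \<le> sign_avg (\<lambda>y. 1 - h y) vs 0"
    by simp
  also have "\<dots> \<le> sign_avg (\<lambda>y. of_bool (\<bar>y\<bar> \<le> t)) vs 0"
    by (rule sign_avg_mono) (rule *)
  finally show ?thesis
    by (simp add: stay_bound_def D_def)
qed

text \<open>
  Averaging over \<open>Y\<close> and \<open>- Y\<close>: both \<open>x + Y\<close> and \<open>x - Y\<close> lie in \<open>[-1, 1]\<close> if
  \<open>\<bar>Y\<bar> \<le> 1 - \<bar>x\<bar>\<close>, and one of them does if \<open>\<bar>Y\<bar> \<le> 1 + \<bar>x\<bar>\<close>.
\<close>

lemma sign_avg_unit_reflection: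
  assumes "\<bar>x\<bar> \<le> 1"
  shows "(sign_avg (\<lambda>y. of_bool (\<bar>y\<bar> \<le> 1 - \<bar>x\<bar>)) vs 0 + sign_avg (\<lambda>y. of_bool (\<bar>y\<bar> \<le> 1 + \<bar>x\<bar>)) vs 0) / 2
    \<le> sign_avg unit_ind vs x"
proof -
  have "sign_avg (\<lambda>y. of_bool (\<bar>y\<bar> \<le> 1 - \<bar>x\<bar>) + of_bool (\<bar>y\<bar> \<le> 1 + \<bar>x\<bar>)) vs 0
      \<le> sign_avg (\<lambda>y. unit_ind (x + y) + unit_ind (- x + y)) vs 0"
    using assms by (intro sign_avg_mono) (auto simp: unit_ind_def)
  also have "\<dots> = 2 * sign_avg unit_ind vs x"
    unfolding sign_avg_add sign_avg_shift by (simp add: sign_avg_unit_even)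
  finally show ?thesis
    by (simp add: sign_avg_add)
qed

lemma sign_avg_ge_stay_bound:
  assumes "1 \<le> r" "\<bar>x\<bar> \<le> 1" "r * sumsq vs \<le> (1 + \<bar>x\<bar>)\<^sup>2"
  shows "stay_bound r \<le> sign_avg unit_ind vs x"
proof -
  have "2 * stay_bound r \<le> sign_avg (\<lambda>y. of_bool (\<bar>y\<bar> \<le> 1 + \<bar>x\<bar>)) vs 0"
    using assms by (intro sign_avg_tail_bound) auto
  moreover have "0 \<le> sign_avg (\<lambda>y. of_bool (\<bar>y\<bar> \<le> 1 - \<bar>x\<bar>)) vs 0"
    by (rule sign_avg_of_bool_nonneg)
  ultimately show ?thesis
    using sign_avg_unit_reflection[OF assms(2), of vs] 
    by (simp add: add_divide_distrib)
qed

section \<open>Stopping the walk\<close>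

text \<open>
  \<open>A\<close> stands for the sum of the squares of the steps already made, and \<open>u\<close> bounds all steps still to come.
  The hypothesis \<open>u * (\<bar>x\<bar> + 2 * u) \<le> A\<close> holds once two revealed signs differ: the steps made then add
  up to at least \<open>\<bar>x\<bar> + 2 * u\<close>, and each is at least \<open>u\<close>. It is preserved by every step, and at the
  stopping time it yields \<open>w + w\<^sup>2 \<le> A\<close> for the next step \<open>w\<close>. The parameter \<open>\<alpha>\<close> records an
  additional lower bound for \<open>A\<close>, which improves the ratio when \<open>w\<close> is small, where \<open>w + w\<^sup>2\<close> says little.
\<close>

lemma stopping_after_turn:
  assumes "sorted_wrt (\<ge>) vs" "\<forall>w\<in>set vs. 0 \<le> w \<and> w \<le> u" "0 \<le> u" "u * (\<bar>x\<bar> + 2 * u) \<le> A"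
    and "\<bar>x\<bar> \<le> 1" "A + sumsq vs \<le> 1" "\<alpha> \<le> A"
    and "1 \<le> r"
    and ratio: "\<And>w. 0 \<le> w \<Longrightarrow> w \<le> 1 \<Longrightarrow> r * min (1 - \<alpha>) (1 - w - w\<^sup>2) \<le> (2 - w)\<^sup>2"
  shows "stay_bound r \<le> sign_avg unit_ind vs x"
  using assms(1-7)
proof (induction vs arbitrary: x A u)
  case Nil
  then show ?case
    using stay_bound_le_half[of r] by (simp add: unit_ind_def)
next
  case (Cons w vs)
  have w0: "0 \<le> w" "w \<le> u"
    using Cons.prems by auto
  then have "w * (\<bar>x\<bar> + 2 * w) \<le> u * (\<bar>x\<bar> + 2 * u)"
    by (intro mult_mono) auto
  then have A: "w * (\<bar>x\<bar> + 2 * w) \<le> A"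
    using Cons.prems by linarith
  moreover have "0 \<le> w * (\<bar>x\<bar> + 2 * w)"
    using w0 by simp
  ultimately have "w\<^sup>2 \<le> 1"
    using Cons.prems(6) sumsq_nonneg[of vs] by simp
  then have w1: "w \<le> 1"
    using w0 by (simp add: abs_square_le_1)
  show ?case
  proof (cases "\<bar>x\<bar> + w \<le> 1")
    case True
    have step: "stay_bound r \<le> sign_avg unit_ind vs y" if y: "\<bar>y\<bar> \<le> \<bar>x\<bar> + w" for y
    proof (rule Cons.IH[of w y "A + w\<^sup>2"])
      have "w * (\<bar>y\<bar> + 2 * w) \<le> w * ((\<bar>x\<bar> + w) + 2 * w)"
        using y w0 by (intro mult_left_mono) auto
      then show "w * (\<bar>y\<bar> + 2 * w) \<le> A + w\<^sup>2"
        using A by (simp add: algebra_simps power2_eq_square)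
      show "\<alpha> \<le> A + w\<^sup>2"
        using Cons.prems(7) by (simp add: add_increasing2)
    qed (use Cons.prems True y in auto)
    have "\<bar>x + w\<bar> \<le> \<bar>x\<bar> + w" "\<bar>x - w\<bar> \<le> \<bar>x\<bar> + w"
      using w0 by auto
    then show ?thesis
      using step[of "x + w"] step[of "x - w"] by simp
  next
    case False
    have "w * (1 + w) \<le> w * (\<bar>x\<bar> + 2 * w)"
      using False w0 by (intro mult_left_mono) auto
    then have "sumsq (w # vs) \<le> min (1 - \<alpha>) (1 - w - w\<^sup>2)"
      using A Cons.prems(6,7) by (simp add: algebra_simps power2_eq_square)
    then have "r * sumsq (w # vs) \<le> r * min (1 - \<alpha>) (1 - w - w\<^sup>2)"
      using \<open>1 \<le> r\<close> by (intro mult_left_mono) auto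
    also have "\<dots> \<le> (2 - w)\<^sup>2"
      by (rule ratio) fact+
    also have "\<dots> \<le> (1 + \<bar>x\<bar>)\<^sup>2"
      using False w1 by (intro power_mono) auto
    finally show ?thesis
      using Cons.prems(5) \<open>1 \<le> r\<close> by (intro sign_avg_ge_stay_bound) auto
  qed
qed

text \<open>
  Ratios \<open>r\<close> available in the previous lemma for the lower bounds \<open>\<alpha> = 0, 1/8, 1/3\<close>. For a positive
  \<open>\<alpha>\<close> the worst step \<open>w\<close> is near the solution of \<open>w + w\<^sup>2 = \<alpha>\<close>, and the case distinction is made
  close to it.
\<close>

lemma turn_ratio_0:
  fixes w :: real
  shows "4 * min (1 - 0) (1 - w - w\<^sup>2) \<le> (2 - w)\<^sup>2"
proof -
  have "4 * (1 - w - w\<^sup>2) \<le> (2 - w)\<^sup>2"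
    by (simp add: power2_eq_square algebra_simps)
  then show ?thesis
    by (simp add: min_def)
qed

lemma turn_ratio_eighth:
  fixes w :: real
  assumes "0 \<le> w" "w \<le> 1"
  shows "(201 / 50) * min (1 - 1 / 8) (1 - w - w\<^sup>2) \<le> (2 - w)\<^sup>2"
proof (cases "w \<le> 11 / 100")
  case True
  then have "(189 / 100)\<^sup>2 \<le> (2 - w)\<^sup>2"
    by (intro power_mono) auto
  then show ?thesis
    by (simp add: power2_eq_square min_def)
next
  case False
  have "(11 / 100)\<^sup>2 \<le> w\<^sup>2"
    using False by (intro power_mono) auto
  then have "(201 / 50) * (1 - w - w\<^sup>2) \<le> (2 - w)\<^sup>2"
    using False by (simp add: power2_eq_square field_simps)
  then show ?thesis
    by (simp add: min_def)
qed

lemma turn_ratio_third: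
  fixes w :: real
  assumes "0 \<le> w" "w \<le> 1"
  shows "(9 / 2) * min (1 - 1 / 3) (1 - w - w\<^sup>2) \<le> (2 - w)\<^sup>2"
proof (cases "w \<le> 13 / 50")
  case True
  then have "(87 / 50)\<^sup>2 \<le> (2 - w)\<^sup>2"
    by (intro power_mono) auto
  then show ?thesis
    by (simp add: power2_eq_square min_def)
next
  case False
  have "(13 / 50)\<^sup>2 \<le> w\<^sup>2"
    using False by (intro power_mono) auto
  then have "(9 / 2) * (1 - w - w\<^sup>2) \<le> (2 - w)\<^sup>2"
    using False by (simp add: power2_eq_square field_simps)
  then show ?thesis
    by (simp add: min_def)
qed

lemma stay_bound_values:
  "stay_bound 4 = 9 / 22" "stay_bound (9 / 2) = 49 / 114" "stay_bound (25 / 7) = 81 / 211"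
  "stay_bound (201 / 50) > 41 / 100" "stay_bound (49 / 13) > 396 / 1000" "stay_bound (27 / 7) > 4 / 10"
  by (simp_all add: stay_bound_def power2_eq_square)

text \<open>
  Here all revealed signs agree, there are at least four of them, and \<open>x\<close> is the sum of the steps made, each of
  which is at least \<open>u\<close>; hence \<open>u * x \<le> A\<close> and \<open>4 * u \<le> x\<close>. The value \<open>27/7\<close> is the ratio for five
  equal steps of length \<open>1/5\<close> stopped after the fourth, which is the extreme case. As soon as a sign
  differs, the hypothesis of the lemma on turned walks is satisfied.
\<close>

lemma stopping_same_signs:
  assumes "sorted_wrt (\<ge>) vs" "\<forall>w\<in>set vs. 0 \<le> w \<and> w \<le> u" "0 \<le> u" "u * x \<le> A" "4 * u \<le> x"
    and "x \<le> 1" "A + sumsq vs \<le> 1"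
  shows "stay_bound (27 / 7) \<le> sign_avg unit_ind vs x"
  using assms
proof (induction vs arbitrary: x A u)
  case Nil
  then show ?case
    using stay_bound_le_half[of "27 / 7"] by (simp add: unit_ind_def)
next
  case (Cons w vs)
  have w: "0 \<le> w" "w \<le> u" "4 * w \<le> x"
    using Cons.prems by auto
  then have "w * x \<le> u * x"
    by (intro mult_right_mono) auto
  then have A: "w * x \<le> A"
    using Cons.prems by linarith
  show ?case
  proof (cases "x + w \<le> 1")
    case True
    have "stay_bound (27 / 7) \<le> sign_avg unit_ind vs (x + w)"
    proof (rule Cons.IH[of w "x + w" "A + w\<^sup>2"])
      show "w * (x + w) \<le> A + w\<^sup>2"
        using A by (simp add: algebra_simps power2_eq_square)
    qed (use Cons.prems True w in auto)
    moreover have "stay_bound (27 / 7) \<le> sign_avg unit_ind vs (x - w)"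
    proof (rule stopping_after_turn[where A = "A + w\<^sup>2" and \<alpha> = 0 and u = w])
      show "w * (\<bar>x - w\<bar> + 2 * w) \<le> A + w\<^sup>2"
        using A w by (simp add: algebra_simps power2_eq_square)
      show "27 / 7 * min (1 - 0) (1 - u - u\<^sup>2) \<le> (2 - u)\<^sup>2" if "0 \<le> u" "u \<le> 1" for u :: real
        using turn_ratio_0[of u] zero_le_power2[of "2 - u"] by linarith
      have "0 \<le> w * x"
        using w by simp
      then show "0 \<le> A + w\<^sup>2"
        using A by simp
    qed (use Cons.prems w True in \<open>auto simp: abs_le_iff\<close>)
    ultimately show ?thesis
      by simp
  next
    case False
    have sq: "sumsq (w # vs) \<le> 1 - w * x"
      using A Cons.prems(7) by simp
    have "27 / 7 * (1 - w * x) \<le> (1 + x)\<^sup>2"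
    \<comment> \<open>For small \<open>w\<close> the stopping condition \<open>x > 1 - w\<close> is the stronger information, for large \<open>w\<close> it
      is \<open>x \<ge> 4 w\<close>; both give \<open>x \<ge> 4/5\<close> at \<open>w = 1/5\<close>.\<close>
    proof (cases "w \<le> 1 / 5")
      case True
      have "(1 - w) * w \<le> x * w"
        using False w by (intro mult_right_mono) auto
      then have "27 / 7 * (1 - w * x) \<le> 27 / 7 * (1 - w + w\<^sup>2)"
        by (simp add: power2_eq_square algebra_simps add_divide_distrib diff_divide_distrib)
      also have "\<dots> \<le> (2 - w)\<^sup>2"
      proof -
        have "0 \<le> (1 / 5 - w) * (1 + 4 * w)"
          using True w by (intro mult_nonneg_nonneg) auto
        moreover have "(2 - w)\<^sup>2 - 27 / 7 * (1 - w + w\<^sup>2) = 5 / 7 * ((1 / 5 - w) * (1 + 4 * w))"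
          by (simp add: power2_eq_square field_simps)
        ultimately show ?thesis
          by linarith
      qed
      also have "\<dots> \<le> (1 + x)\<^sup>2"
        using False True by (intro power_mono) auto
      finally show ?thesis .
    next
      case False
      then have "1 / 5 * (4 / 5) \<le> w * x"
        using w by (intro mult_mono) auto
      moreover have "(9 / 5)\<^sup>2 \<le> (1 + x)\<^sup>2"
        using False w by (intro power_mono) auto
      ultimately show ?thesis
        by (simp add: power2_eq_square)
    qed
    with sq have "27 / 7 * sumsq (w # vs) \<le> (1 + \<bar>x\<bar>)\<^sup>2"
      using w by simp
    then show ?thesis
      using Cons.prems w by (intro sign_avg_ge_stay_bound) auto
  qed
qed

section \<open>Two coefficients with sum greater than one\<close>

text \<open>
  The step \<open>u\<close> is kept for the end. If the walk reaches it without stopping, one of the two signs of \<open>u\<close>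
  brings the sum back towards \<open>0\<close>, so the probability is at least \<open>1/2\<close> there. If the walk stops
  before \<open>w\<close>, the variance left, including \<open>u\<^sup>2\<close>, is at most \<open>3/4 - w\<^sup>2\<close> because the largest
  coefficient and another one of size at least \<open>w\<close> have been used.
\<close>

lemma stopping_reserved_step:
  assumes "\<forall>w\<in>set vs. 0 \<le> w \<and> 1 / 4 + w\<^sup>2 \<le> A" "\<bar>x\<bar> \<le> 1" "0 \<le> u" "u \<le> 1"
    and "A + sumsq vs + u\<^sup>2 \<le> 1"
  shows "stay_bound 4 \<le> sign_avg unit_ind (vs @ [u]) x"
  using assms
proof (induction vs arbitrary: x A)
  case Nil
  then have "\<bar>x + u\<bar> \<le> 1 \<or> \<bar>x - u\<bar> \<le> 1"
    by (auto simp: abs_le_iff)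
  then have "1 / 2 \<le> sign_avg unit_ind [u] x"
    by (auto simp: unit_ind_def)
  then show ?case
    using stay_bound_le_half[of 4] by simp
next
  case (Cons w vs)
  have w: "0 \<le> w" "1 / 4 + w\<^sup>2 \<le> A"
    using Cons.prems by auto
  have "w\<^sup>2 \<le> 1"
    using Cons.prems(5) w(2) sumsq_nonneg[of vs] zero_le_power2[of u] zero_le_power2[of w]
    unfolding list.map sum_list.Cons by linarith
  then have w1: "w \<le> 1"
    using w by (simp add: abs_square_le_1)
  show ?case
  proof (cases "\<bar>x\<bar> + w \<le> 1")
    case True
    have step: "stay_bound 4 \<le> sign_avg unit_ind (vs @ [u]) y" if "\<bar>y\<bar> \<le> 1" for y
      by (rule Cons.IH[of "A + w\<^sup>2"]) (use Cons.prems that in \<open>auto intro: add_increasing2\<close>)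
    have "\<bar>x + w\<bar> \<le> 1" "\<bar>x - w\<bar> \<le> 1"
      using True w by auto
    then show ?thesis
      using step[of "x + w"] step[of "x - w"] by simp
  next
    case False
    have "sumsq (w # vs @ [u]) \<le> 3 / 4 - w\<^sup>2"
      using Cons.prems(5) w by simp
    then have "4 * sumsq (w # vs @ [u]) \<le> 4 * (3 / 4 - w\<^sup>2)"
      by (intro mult_left_mono) auto
    also have "\<dots> \<le> (2 - w)\<^sup>2"
      using zero_le_power2[of "5 * w - 2"] by (simp add: power2_eq_square algebra_simps)
    also have "\<dots> \<le> (1 + \<bar>x\<bar>)\<^sup>2"
      using False w1 by (intro power_mono) auto
    finally have "4 * sumsq (w # vs @ [u]) \<le> (1 + \<bar>x\<bar>)\<^sup>2" .
    then show ?thesis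
      using Cons.prems(2) sign_avg_ge_stay_bound[of 4 x "w # vs @ [u]"] by simp
  qed
qed

text \<open>
  Two steps of nearly equal size, at most \<open>1\<close> together, retain at least three of the four signed values when
  \<open>\<bar>z\<bar> \<le> 1 - (d - e)\<close>, two up to \<open>1 + (d - e)\<close>, and one up to \<open>1 + (d + e)\<close>. The parabola lies below this
  step function, so averaging over \<open>z\<close> needs only a second moment.
\<close>

lemma two_reserved_steps:
  fixes d e z :: real
  assumes "0 \<le> e" "e \<le> d" "d - e \<le> 1 / 5" "4 / 5 \<le> d + e" "d + e \<le> 1"
  shows "3 / 4 - z\<^sup>2 / 2 \<le> sign_avg unit_ind [d, e] z"
proof -
  have *: "3 / 4 - z\<^sup>2 / 2 \<le> sign_avg unit_ind [d, e] z" if z: "0 \<le> z" for z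
  proof -
    consider "z \<le> 1 - (d - e)" | "1 - (d - e) < z" "z \<le> 1 + (d - e)" | "1 + (d - e) < z" "z \<le> 1 + (d + e)" | "1 + (d + e) < z"
      by linarith
    then show ?thesis
    proof cases
      case 1
      have "3 / 4 \<le> sign_avg unit_ind [d, e] z"
        using 1 assms z by (auto simp: unit_ind_def abs_le_iff)
      then show ?thesis
        by (smt (verit) zero_le_power2 divide_nonneg_nonneg)
    next
      case 2
      have "(4 / 5)\<^sup>2 \<le> z\<^sup>2"
        using 2 assms by (intro power_mono) auto
      moreover have "1 / 2 \<le> sign_avg unit_ind [d, e] z"
        using 2 assms z by (auto simp: unit_ind_def abs_le_iff)
      ultimately show ?thesis
        by (simp add: power2_eq_square)
    next
      case 3
      have "1\<^sup>2 \<le> z\<^sup>2"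
        using 3 assms by (intro power_mono) auto
      moreover have "1 / 4 \<le> sign_avg unit_ind [d, e] z"
        using 3 assms z by (auto simp: unit_ind_def abs_le_iff)
      ultimately show ?thesis
        by (simp add: add_divide_distrib)
    next
      case 4
      have "(9 / 5)\<^sup>2 \<le> z\<^sup>2"
        using 4 assms by (intro power_mono) auto
      moreover have "0 \<le> sign_avg unit_ind [d, e] z"
        by (auto simp: unit_ind_def)
      ultimately show ?thesis
        by (simp add: power2_eq_square)
    qed
  qed
  show ?thesis
    using *[of z] *[of "- z"] sign_avg_unit_even[of "[d, e]" z] by (cases "0 \<le> z") (auto simp del: sign_avg.simps)
qed

text \<open>
  The points \<open>a - b + c\<close> and \<open>a - b - c\<close> have modulus at most \<open>a\<close>, hence distance at least \<open>1 - a\<close> from the ends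
  of the interval. Since \<open>b\<^sup>2 + c\<^sup>2 \<ge> 1/2\<close>, the remaining standard deviation is at most \<open>1 - a\<close>, which is
  why \<open>rest\<close> applies. A bound on the variance alone does not prevent the remainder from being concentrated near
  \<open>-(1 - a)\<close> and \<open>1 - a\<close>, so a lower bound of this kind is needed.
\<close>

lemma three_large_coefficients:
  assumes ord: "c \<le> b" "b \<le> a" "a \<le> 3 / 5" "1 < b + c"
    and sq: "a\<^sup>2 + b\<^sup>2 + c\<^sup>2 + sumsq vs \<le> 1"
    and rest: "sumsq vs \<le> (1 - a)\<^sup>2 \<Longrightarrow> 2 / 5 \<le> sign_avg (\<lambda>y. of_bool (\<bar>y\<bar> \<le> 1 - a)) vs 0"
  shows "9 / 22 \<le> sign_avg unit_ind (b # c # vs) a"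
proof -
  have bc: "1 / 2 \<le> b\<^sup>2 + c\<^sup>2"
    using zero_le_power2[of "b - 1 / 2"] zero_le_power2[of "c - 1 / 2"] ord
    by (simp add: power2_eq_square algebra_simps)
  have "(1 / 2)\<^sup>2 \<le> a\<^sup>2"
    using ord by (intro power_mono) auto
  with bc sq have quarter: "sumsq vs \<le> 1 / 4"
    by (simp add: power2_eq_square)
  have far: "18 / 19 \<le> sign_avg (\<lambda>y. of_bool (\<bar>y\<bar> \<le> 1 + t)) vs 0" if "2 / 5 \<le> t" for t
  proof -
    have "18 / 19 = 2 * stay_bound 7"
      by (simp add: stay_bound_def)
    also have "\<dots> \<le> sign_avg (\<lambda>y. of_bool (\<bar>y\<bar> \<le> 1 + t)) vs 0"
    proof (rule sign_avg_tail_bound)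
      have "(7 / 5)\<^sup>2 \<le> (1 + t)\<^sup>2"
        using that by (intro power_mono) auto
      then show "7 * sumsq vs \<le> (1 + t)\<^sup>2"
        using quarter by (simp add: power2_eq_square)
    qed (use that in auto)
    finally show ?thesis .
  qed
  have "sumsq vs \<le> (1 - a)\<^sup>2"
    using sq bc zero_le_power2[of "2 * a - 1"] by (simp add: power2_eq_square algebra_simps)
  then have "2 / 5 \<le> sign_avg (\<lambda>y. of_bool (\<bar>y\<bar> \<le> 1 - a)) vs 0"
    by (rule rest)
  also have "\<dots> \<le> sign_avg (\<lambda>y. of_bool (\<bar>y\<bar> \<le> t)) vs 0" if "1 - a \<le> t" for t
    using that by (intro sign_avg_mono) auto
  finally have near: "2 / 5 \<le> sign_avg (\<lambda>y. of_bool (\<bar>y\<bar> \<le> t)) vs 0" if "1 - a \<le> t" for t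
    using that .
  have inner: "(2 / 5 + 18 / 19) / 2 \<le> sign_avg unit_ind vs x" if "2 / 5 \<le> \<bar>x\<bar>" "\<bar>x\<bar> \<le> a" for x
    using near[of "1 - \<bar>x\<bar>"] far[of "\<bar>x\<bar>"] sign_avg_unit_reflection[of x vs] that ord by simp
  have outer: "(18 / 19) / 2 \<le> sign_avg unit_ind vs (a + b - c)"
    using far[of "\<bar>a + b - c\<bar>"] sign_avg_unit_reflection[of "a + b - c" vs]
      sign_avg_of_bool_nonneg[of "\<lambda>y. \<bar>y\<bar> \<le> 1 - \<bar>a + b - c\<bar>" vs 0] ord by simp
  have "0 \<le> sign_avg unit_ind vs (a + b + c)"
    by (simp add: unit_ind_def[abs_def] sign_avg_of_bool_nonneg)
  with inner[of "a - b + c"] inner[of "a - b - c"] outer ord show ?thesis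
    by (simp add: field_simps)
qed

lemma two_large_coefficients:
  assumes sorted: "sorted_wrt (\<ge>) (a # b # c # vs)" "\<forall>w\<in>set (a # b # c # vs). 0 \<le> w"
    and sq: "sumsq (a # b # c # vs) \<le> 1"
    and large: "1 < a + b"
    and rest: "a < 1 \<Longrightarrow> sumsq vs \<le> (1 - a)\<^sup>2 \<Longrightarrow> 2 / 5 \<le> sign_avg (\<lambda>y. of_bool (\<bar>y\<bar> \<le> 1 - a)) vs 0"
  shows "9 / 22 \<le> sign_avg unit_ind (a # b # c # vs) 0"
proof -
  have ord: "0 \<le> c" "c \<le> b" "b \<le> a" "1 / 2 < a" "\<forall>w\<in>set vs. 0 \<le> w \<and> w \<le> c"
    using sorted large by auto
  have a2: "1 / 4 \<le> a\<^sup>2"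
    using power_mono[of "1 / 2" a 2] ord by (simp add: power2_eq_square)
  have nonneg: "0 \<le> a\<^sup>2" "0 \<le> b\<^sup>2" "0 \<le> c\<^sup>2" "0 \<le> sumsq vs"
    by (auto intro: sumsq_nonneg)
  have sq': "a\<^sup>2 + b\<^sup>2 + c\<^sup>2 + sumsq vs \<le> 1"
    using sq by simp
  have a1: "a\<^sup>2 \<le> 1" "b\<^sup>2 \<le> 1"
    using nonneg sq' by linarith+
  then have a1: "a \<le> 1" "b \<le> 1"
    using ord by (auto simp: abs_square_le_1)
  have first: "sign_avg unit_ind (a # us) 0 = sign_avg unit_ind us a" for us
    using sign_avg_unit_even[of us a] by simp
  consider "a + c \<le> 1" | "3 / 5 \<le> a" | "1 < a + c" "a < 3 / 5" "b + c \<le> 1" | "a < 3 / 5" "1 < b + c"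
    by linarith
  then show ?thesis
  proof cases
    case 1
    have *: "stay_bound 4 \<le> sign_avg unit_ind (vs @ [b]) y" if "\<bar>y\<bar> \<le> 1" for y
    proof (rule stopping_reserved_step[where A = "a\<^sup>2 + c\<^sup>2"])
      show "\<forall>w\<in>set vs. 0 \<le> w \<and> 1 / 4 + w\<^sup>2 \<le> a\<^sup>2 + c\<^sup>2"
        using a2 ord by (auto intro!: add_mono power_mono)
    qed (use that a1 ord sq' in auto)
    have "stay_bound 4 \<le> sign_avg unit_ind (c # vs @ [b]) a"
      using *[of "a + c"] *[of "a - c"] 1 ord a1 by simp
    also have "\<dots> = sign_avg unit_ind (b # c # vs) a"
      by (rule sign_avg_perm) simp
    finally show ?thesis
      by (simp add: first stay_bound_values del: sign_avg.simps)
  next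
    case 2
    have "4 * (1 - a) \<le> 1 + a"
      using 2 by simp
    then have "4 * (1 - a) * (1 + a) \<le> (1 + a) * (1 + a)"
      using ord by (intro mult_right_mono) auto
    then have "4 * (1 - a\<^sup>2) \<le> (1 + a)\<^sup>2"
      by (simp add: power2_eq_square algebra_simps)
    then have "stay_bound 4 \<le> sign_avg unit_ind (b # c # vs) a"
      using a1 ord sq' by (intro sign_avg_ge_stay_bound) auto
    then show ?thesis
      by (simp add: first stay_bound_values del: sign_avg.simps)
  next
    case 3
    have "(2 / 5)\<^sup>2 \<le> c\<^sup>2" "(2 / 5)\<^sup>2 \<le> b\<^sup>2"
      using 3 ord by (auto intro!: power_mono)
    then have *: "a\<^sup>2 + sumsq vs \<le> 17 / 25"
      using sq' by (simp add: power2_eq_square)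
    have "9 / 22 \<le> 3 / 4 + (- 1 / 2) * (a\<^sup>2 + sumsq vs)"
      using * by (simp add: add_divide_distrib)
    also have "\<dots> = sign_avg (\<lambda>z. 3 / 4 + (- 1 / 2) * z\<^sup>2) vs a"
      by (simp only: sign_avg_add sign_avg_const sign_avg_cmult sign_avg_square)
    also have "\<dots> \<le> sign_avg (sign_avg unit_ind [b, c]) vs a"
    proof (rule sign_avg_mono)
      fix z
      show "3 / 4 + (- 1 / 2) * z\<^sup>2 \<le> sign_avg unit_ind [b, c] z"
        using two_reserved_steps[of c b z] 3 ord a1 by simp
    qed
    also have "\<dots> = sign_avg unit_ind (vs @ [b, c]) a"
      by (simp add: sign_avg_append)
    also have "\<dots> = sign_avg unit_ind (b # c # vs) a"
      by (rule sign_avg_perm) simp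
    finally show ?thesis
      by (simp add: first del: sign_avg.simps)
  next
    case 4
    then show ?thesis
      using three_large_coefficients[OF ord(2,3) _ _ sq' rest] by (simp add: first del: sign_avg.simps)
  qed
qed

section \<open>The bound for sorted coefficients\<close>

lemma sign_avg_step:
  "p \<le> sign_avg f vs (x + v) \<Longrightarrow> q \<le> sign_avg f vs (x - v) \<Longrightarrow> (p + q) / 2 \<le> sign_avg f (v # vs) x"
  by simp

text \<open>
  The cases are \<open>k = 1\<close>, \<open>k = 2\<close>, \<open>k = 3\<close> and \<open>k \<ge> 4\<close>, where \<open>k\<close> is maximal such that the \<open>k\<close> largest
  coefficients have sum at most \<open>1\<close>. For \<open>k = 2\<close> and \<open>k = 3\<close> the worst ratio in the branch \<open>same\<close> of equal
  signs is approached when the first \<open>k + 1\<close> coefficients tend to \<open>1 / (k + 1)\<close>, which gives \<open>25/7\<close> and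
  \<open>49/13\<close>. The averages of the bounds over the branches are about \<open>0.4069\<close>, \<open>0.4067\<close> and \<open>0.4082\<close> for
  \<open>k = 2\<close>, \<open>k = 3\<close> and \<open>k \<ge> 4\<close>.
\<close>

lemma sorted_bound:
  assumes sorted: "sorted_wrt (\<ge>) (a # b # c # d # vs)" "\<forall>w\<in>set (a # b # c # d # vs). 0 \<le> w"
    and sq: "sumsq (a # b # c # d # vs) \<le> 1"
    and rest: "0 < a \<Longrightarrow> a < 1 \<Longrightarrow> sumsq (d # vs) \<le> (1 - a)\<^sup>2
      \<Longrightarrow> 2 / 5 \<le> sign_avg (\<lambda>y. of_bool (\<bar>y\<bar> \<le> 1 - a)) (d # vs) 0"
  shows "4063 / 10000 \<le> sign_avg unit_ind (a # b # c # d # vs) 0"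
proof (cases "1 < a + b")
  case True
  with sorted(1) have "0 < a"
    by auto
  with True show ?thesis
    using two_large_coefficients[of a b c "d # vs"] assms by (simp del: sign_avg.simps)
next
  case False
  have ord: "0 \<le> d" "d \<le> c" "c \<le> b" "b \<le> a"
    and ordered: "sorted_wrt (\<ge>) vs" "\<forall>w\<in>set vs. 0 \<le> w \<and> w \<le> d"
    using sorted by auto
  have sq': "a\<^sup>2 + b\<^sup>2 + c\<^sup>2 + d\<^sup>2 + sumsq vs \<le> 1"
    using sq by simp
  have first: "sign_avg unit_ind (a # us) 0 = sign_avg unit_ind us a" for us
    using sign_avg_unit_even[of us a] by simp
  have ab: "c * (\<bar>a - b\<bar> + 2 * c) \<le> a\<^sup>2 + b\<^sup>2"
  proof -
    have "c * (\<bar>a - b\<bar> + 2 * c) \<le> b * (a + b)"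
      using ord by (intro mult_mono) auto
    also have "\<dots> \<le> a\<^sup>2 + b\<^sup>2"
      using ord mult_right_mono[of b a a] by (simp add: power2_eq_square algebra_simps)
    finally show ?thesis .
  qed
  have abc: "d * (\<bar>y\<bar> + 2 * d) \<le> a\<^sup>2 + b\<^sup>2 + c\<^sup>2" if "\<bar>y\<bar> \<le> a + b - c" for y
  proof -
    have "d * (\<bar>y\<bar> + 2 * d) \<le> c * (a + b + c)"
      using ord that by (intro mult_mono) auto
    also have "\<dots> \<le> a\<^sup>2 + b\<^sup>2 + c\<^sup>2"
      using ord mult_right_mono[of c a a] mult_right_mono[of c b b]
      by (simp add: power2_eq_square algebra_simps)
    finally show ?thesis .
  qed
  consider "1 < a + b + c" | "a + b + c \<le> 1" "1 < a + b + c + d" | "a + b + c + d \<le> 1"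
    by linarith
  then show ?thesis
  proof cases
    case 1
    have third: "1 / 3 \<le> a\<^sup>2 + b\<^sup>2 + c\<^sup>2"
      using zero_le_power2[of "a - 1 / 3"] zero_le_power2[of "b - 1 / 3"] zero_le_power2[of "c - 1 / 3"] 1
      by (simp add: power2_eq_square algebra_simps)
    have same: "stay_bound (25 / 7) \<le> sign_avg unit_ind (c # d # vs) (a + b)"
    proof (rule sign_avg_ge_stay_bound)
      have "(a + b)\<^sup>2 \<le> 2 * (a\<^sup>2 + b\<^sup>2)"
        using zero_le_power2[of "a - b"] by (simp add: power2_eq_square algebra_simps)
      then have "25 / 7 * sumsq (c # d # vs) \<le> 25 / 7 * (1 - (a + b)\<^sup>2 / 2)"
        using sq' by simp
      also have "\<dots> \<le> (1 + (a + b))\<^sup>2"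
      proof -
        have "2 / 3 \<le> a + b"
          using 1 ord by simp
        then have "(2 / 3)\<^sup>2 \<le> (a + b)\<^sup>2" "(5 / 3)\<^sup>2 \<le> (1 + (a + b))\<^sup>2"
          by (auto intro!: power_mono)
        then show ?thesis
          by (simp add: power2_eq_square)
      qed
      finally show "25 / 7 * sumsq (c # d # vs) \<le> (1 + \<bar>a + b\<bar>)\<^sup>2"
        using ord by simp
    qed (use False ord in auto)
    have turned: "stay_bound (9 / 2) \<le> sign_avg unit_ind (d # vs) y" if y: "\<bar>y\<bar> \<le> a - b + c" for y
    proof (rule stopping_after_turn[where A = "a\<^sup>2 + b\<^sup>2 + c\<^sup>2" and \<alpha> = "1 / 3" and u = d])
      show "d * (\<bar>y\<bar> + 2 * d) \<le> a\<^sup>2 + b\<^sup>2 + c\<^sup>2"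
        using y ord by (intro abc) auto
    qed (use third sq' y ord ordered False turn_ratio_third in auto)
    have "(stay_bound (9 / 2) + stay_bound (9 / 2)) / 2 \<le> sign_avg unit_ind (c # d # vs) (a - b)"
      using ord by (intro sign_avg_step turned) auto
    from sign_avg_step[OF same this] show ?thesis
      unfolding first by (rule order.trans[rotated]) (simp add: stay_bound_values)
  next
    case 2
    have "1 / 2 \<le> a + b"
      using 2 ord by linarith
    then have eighth: "1 / 8 \<le> a\<^sup>2 + b\<^sup>2"
      using zero_le_power2[of "a - 1 / 4"] zero_le_power2[of "b - 1 / 4"]
      by (simp add: power2_eq_square algebra_simps)
    have same: "stay_bound (49 / 13) \<le> sign_avg unit_ind (d # vs) (a + b + c)"
    proof (rule sign_avg_ge_stay_bound)
      have "(a + b + c)\<^sup>2 \<le> 3 * (a\<^sup>2 + b\<^sup>2 + c\<^sup>2)"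
        using zero_le_power2[of "a - b"] zero_le_power2[of "a - c"] zero_le_power2[of "b - c"]
        by (simp add: power2_eq_square algebra_simps)
      then have "49 / 13 * sumsq (d # vs) \<le> 49 / 13 * (1 - (a + b + c)\<^sup>2 / 3)"
        using sq' by simp
      also have "\<dots> \<le> (1 + (a + b + c))\<^sup>2"
      proof -
        have "3 / 4 \<le> a + b + c"
          using 2 ord by simp
        then have "(3 / 4)\<^sup>2 \<le> (a + b + c)\<^sup>2" "(7 / 4)\<^sup>2 \<le> (1 + (a + b + c))\<^sup>2"
          by (auto intro!: power_mono)
        then show ?thesis
          by (simp add: power2_eq_square)
      qed
      finally show "49 / 13 * sumsq (d # vs) \<le> (1 + \<bar>a + b + c\<bar>)\<^sup>2"
        using ord by simp
    qed (use 2 ord in auto)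
    have third: "stay_bound (201 / 50) \<le> sign_avg unit_ind (d # vs) (a + b - c)"
    proof (rule stopping_after_turn[where A = "a\<^sup>2 + b\<^sup>2 + c\<^sup>2" and \<alpha> = "1 / 8" and u = d])
      show "1 / 8 \<le> a\<^sup>2 + b\<^sup>2 + c\<^sup>2"
        using eighth by (simp add: add_increasing2)
    qed (use abc[of "a + b - c"] sq' ord ordered False turn_ratio_eighth in auto)
    have second: "stay_bound (201 / 50) \<le> sign_avg unit_ind (c # d # vs) (a - b)"
      by (rule stopping_after_turn[where A = "a\<^sup>2 + b\<^sup>2" and \<alpha> = "1 / 8" and u = c])
        (use ab eighth sq' ord ordered False turn_ratio_eighth in auto)
    from sign_avg_step[OF sign_avg_step[OF same third] second] show ?thesis
      unfolding first by (rule order.trans[rotated]) (use stay_bound_values in \<open>simp add: add_divide_distrib\<close>)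
  next
    case 3
    have abcd: "d * (a + b + c + d) \<le> a\<^sup>2 + b\<^sup>2 + c\<^sup>2 + d\<^sup>2"
      using ord mult_right_mono[of d a a] mult_right_mono[of d b b] mult_right_mono[of d c c]
      by (simp add: power2_eq_square algebra_simps)
    have same: "stay_bound (27 / 7) \<le> sign_avg unit_ind vs (a + b + c + d)"
      by (rule stopping_same_signs[where A = "a\<^sup>2 + b\<^sup>2 + c\<^sup>2 + d\<^sup>2" and u = d])
        (use abcd sq' ord ordered 3 in auto)
    have fourth: "stay_bound 4 \<le> sign_avg unit_ind vs (a + b + c - d)"
    proof (rule stopping_after_turn[where A = "a\<^sup>2 + b\<^sup>2 + c\<^sup>2 + d\<^sup>2" and \<alpha> = 0 and u = d])
      show "d * (\<bar>a + b + c - d\<bar> + 2 * d) \<le> a\<^sup>2 + b\<^sup>2 + c\<^sup>2 + d\<^sup>2"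
        using abcd ord by (simp add: algebra_simps)
    qed (use sq' ord ordered 3 turn_ratio_0 in auto)
    have third: "stay_bound 4 \<le> sign_avg unit_ind (d # vs) (a + b - c)"
      by (rule stopping_after_turn[where A = "a\<^sup>2 + b\<^sup>2 + c\<^sup>2" and \<alpha> = 0 and u = d])
        (use abc[of "a + b - c"] sq' ord ordered 3 turn_ratio_0 in auto)
    have second: "stay_bound 4 \<le> sign_avg unit_ind (c # d # vs) (a - b)"
      by (rule stopping_after_turn[where A = "a\<^sup>2 + b\<^sup>2" and \<alpha> = 0 and u = c])
        (use ab sq' ord ordered 3 turn_ratio_0 in auto)
    from sign_avg_step[OF sign_avg_step[OF sign_avg_step[OF same fourth] third] second] show ?thesis
      unfolding first by (rule order.trans[rotated]) (use stay_bound_values in \<open>simp add: add_divide_distrib\<close>)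
  qed
qed

lemma sign_avg_scale: "sign_avg (\<lambda>y. f (k * y)) vs x = sign_avg f (map ((*) k) vs) (k * x)"
  by (induction vs arbitrary: x) (auto simp: algebra_simps)

text \<open>
  The induction is on the number of nonzero coefficients rather than on the length of the list, because the list
  is padded with zeros to have at least four entries.
\<close>

lemma sign_avg_unit_ge:
  "sumsq vs \<le> 1 \<Longrightarrow> 4063 / 10000 \<le> sign_avg unit_ind vs 0"
proof (induction "length (filter (\<lambda>v. v \<noteq> 0) vs)" arbitrary: vs rule: less_induct)
  case less
  define us where "us = rev (sort (map abs vs)) @ replicate 4 (0 :: real)"
  have "length us \<ge> 4"
    by (simp add: us_def)
  then obtain a b c d ws where us: "us = a # b # c # d # ws"
    by (auto simp: numeral_eq_Suc Suc_le_length_iff)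
  have perm: "mset us = mset (map abs vs @ replicate 4 0)"
    by (simp add: us_def)
  have eq: "sign_avg unit_ind us 0 = sign_avg unit_ind vs 0"
    unfolding sign_avg_perm[OF perm] sign_avg_replicate_zero sign_avg_abs ..
  have "sorted_wrt (\<ge>) (rev (sort (map abs vs)))"
    by (simp add: sorted_wrt_rev)
  then have sorted: "sorted_wrt (\<ge>) us"
    by (auto simp: us_def sorted_wrt_append numeral_eq_Suc)
  have nonneg: "\<forall>w\<in>set us. 0 \<le> w"
    by (auto simp: us_def)
  have "sumsq us = sumsq (map abs vs @ replicate 4 0)"
    using perm by (metis mset_map sum_mset_sum_list)
  also have "\<dots> = sumsq vs"
    by (simp add: comp_def sum_list_replicate)
  finally have sq: "sumsq us \<le> 1"
    using less.prems by simp
  have count: "length (filter (\<lambda>v. v \<noteq> 0) us) = length (filter (\<lambda>v. v \<noteq> 0) vs)"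
  proof -
    have "length (filter (\<lambda>v. v \<noteq> 0) us) = size (filter_mset (\<lambda>v. v \<noteq> 0) (mset us))"
      by (metis mset_filter size_mset)
    also have "\<dots> = length (filter (\<lambda>v. v \<noteq> 0) (map abs vs @ replicate 4 (0::real)))"
      unfolding perm by (metis mset_filter size_mset)
    also have "\<dots> = length (filter (\<lambda>v. v \<noteq> 0) vs)"
      by (simp add: filter_map comp_def)
    finally show ?thesis .
  qed
  have "4063 / 10000 \<le> sign_avg unit_ind (a # b # c # d # ws) 0"
  proof (rule sorted_bound)
    assume a: "0 < a" "a < 1" and small: "sumsq (d # ws) \<le> (1 - a)\<^sup>2"
    define ks where "ks = map ((*) (1 / (1 - a))) (d # ws)"
    have fewer: "length (filter (\<lambda>v. v \<noteq> 0) ks) < length (filter (\<lambda>v. v \<noteq> 0) vs)"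
      using a unfolding count[symmetric] us ks_def by (auto simp: filter_map comp_def)
    have "sumsq ks = (1 / (1 - a))\<^sup>2 * sumsq (d # ws)"
      unfolding ks_def by (simp only: map_map comp_def power_mult_distrib sum_list_const_mult)
    also have "\<dots> \<le> (1 / (1 - a))\<^sup>2 * (1 - a)\<^sup>2"
      using small by (intro mult_left_mono) auto
    also have "\<dots> = 1"
      using a by (simp add: power_mult_distrib[symmetric])
    finally have "sumsq ks \<le> 1" .
    with fewer have "4063 / 10000 \<le> sign_avg unit_ind ks 0"
      by (rule less.hyps)
    also have "\<dots> = sign_avg (\<lambda>y. unit_ind (1 / (1 - a) * y)) (d # ws) 0"
      unfolding sign_avg_scale ks_def by simp
    also have "(\<lambda>y. unit_ind (1 / (1 - a) * y)) = (\<lambda>y. of_bool (\<bar>y\<bar> \<le> 1 - a))"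
      using a by (auto simp: unit_ind_def fun_eq_iff abs_mult divide_simps)
    finally show "2 / 5 \<le> sign_avg (\<lambda>y. of_bool (\<bar>y\<bar> \<le> 1 - a)) (d # ws) 0"
      by simp
  qed (use sorted nonneg sq us in auto)
  then show ?case
    unfolding us[symmetric] eq .
qed

section \<open>Random signs on a probability space\<close>

lemma random_sign_prob:
  assumes "random_sign M X" "s \<in> {-1, 1}"
  shows "measure M (X -` {s} \<inter> space M) = 1 / 2"
proof -
  have "measure M (X -` {s} \<inter> space M) = measure (distr M borel X) {s}"
    using assms(1) by (subst measure_distr) (auto simp: random_sign_def)
  also have "\<dots> = measure (distr (measure_pmf (pmf_of_set {-1, 1})) borel (\<lambda>x. x)) {s}"
    using assms(1) by (simp add: random_sign_def)
  also have "\<dots> = pmf (pmf_of_set {-1, 1}) s"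
    by (subst measure_distr) (auto simp: measure_pmf_single)
  also have "\<dots> = 1 / 2"
    using assms(2) by (subst pmf_of_set) auto
  finally show ?thesis .
qed

text \<open>
  Conditioning on the last sign unfolds one step of the average; the list is reversed so that this sign belongs
  to its head.
\<close>

lemma (in prob_space) prob_signed_sum:
  fixes a :: "nat \<Rightarrow> 'a \<Rightarrow> real"
  assumes "\<And>i. i \<in> {1..n} \<Longrightarrow> random_sign M (a i)" "indep_vars (\<lambda>_. borel) a {1..n}" "B \<in> sets borel"
  shows "prob {\<omega> \<in> space M. x + (\<Sum>i=1..n. a i \<omega> * v i) \<in> B}
    = sign_avg (\<lambda>y. of_bool (y \<in> B)) (map v (rev [1..<Suc n])) x"
  using assms(1,2)
proof (induction n arbitrary: x)
  case 0
  then show ?case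
    by (simp add: prob_space)
next
  case (Suc n)
  let ?S = "\<lambda>\<omega>. \<Sum>i=1..n. a i \<omega> * v i"
  let ?a = "a (Suc n)"
  have meas [measurable]: "a i \<in> borel_measurable M" if "i \<in> {1..Suc n}" for i
    using Suc.prems(1)[OF that] by (simp add: random_sign_def)
  then have [measurable]: "?S \<in> borel_measurable M" "?a \<in> borel_measurable M"
    by (auto intro!: borel_measurable_sum borel_measurable_times)
  have IH: "prob {\<omega> \<in> space M. y + ?S \<omega> \<in> B} = sign_avg (\<lambda>y. of_bool (y \<in> B)) (map v (rev [1..<Suc n])) y" for y
    using Suc.prems by (intro Suc.IH) (auto intro: indep_vars_subset)
  have "indep_var borel ((\<lambda>f. f (Suc n)) \<circ> (\<lambda>\<omega>. restrict (\<lambda>i. a i \<omega>) {Suc n}))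
    borel ((\<lambda>f. \<Sum>i\<in>{1..n}. f i * v i) \<circ> (\<lambda>\<omega>. restrict (\<lambda>i. a i \<omega>) {1..n}))"
    by (intro indep_var_compose[OF indep_var_restrict[OF Suc.prems(2)]])
      (auto intro!: borel_measurable_sum borel_measurable_times measurable_component_singleton)
  also have "(\<lambda>f. f (Suc n)) \<circ> (\<lambda>\<omega>. restrict (\<lambda>i. a i \<omega>) {Suc n}) = ?a"
    by auto
  also have "(\<lambda>f. \<Sum>i\<in>{1..n}. f i * v i) \<circ> (\<lambda>\<omega>. restrict (\<lambda>i. a i \<omega>) {1..n}) = ?S"
    by auto
  finally have ind: "indep_var borel ?a borel ?S" .
  define E where "E s = {\<omega> \<in> space M. ?a \<omega> = s \<and> (x + s * v (Suc n)) + ?S \<omega> \<in> B}" for s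
  have [measurable]: "E s \<in> events" for s
    unfolding E_def using assms(3) by measurable
  have half: "prob (?a -` {s} \<inter> space M) = 1 / 2" if "s \<in> {-1, 1}" for s
    using Suc.prems(1) that by (intro random_sign_prob) auto
  have E: "prob (E s) = 1 / 2 * sign_avg (\<lambda>y. of_bool (y \<in> B)) (map v (rev [1..<Suc n])) (x + s * v (Suc n))"
    if "s \<in> {-1, 1}" for s
  proof -
    let ?B = "(\<lambda>y. (x + s * v (Suc n)) + y) -` B"
    have B: "?B \<in> sets borel"
      using measurable_sets[of "\<lambda>y. (x + s * v (Suc n)) + y" borel borel B] assms(3) by simp
    have "prob (E s) = prob ((\<lambda>\<omega>. (?a \<omega>, ?S \<omega>)) -` ({s} \<times> ?B) \<inter> space M)"
      by (auto simp: E_def intro!: arg_cong[where f = prob])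
    also have "\<dots> = prob (?a -` {s} \<inter> space M) * prob (?S -` ?B \<inter> space M)"
      by (rule indep_varD[OF ind _ B]) simp
    also have "?S -` ?B \<inter> space M = {\<omega> \<in> space M. (x + s * v (Suc n)) + ?S \<omega> \<in> B}"
      by auto
    finally show ?thesis
      unfolding half[OF that] IH .
  qed
  \<comment> \<open>A random sign may take other values, but only on a null set.\<close>
  have "prob (?a -` {-1} \<inter> space M \<union> ?a -` {1} \<inter> space M) = 1"
    by (subst finite_measure_Union) (auto simp: half)
  then have "AE \<omega> in M. ?a \<omega> = -1 \<or> ?a \<omega> = 1"
    by (subst (asm) prob_eq_1) auto
  then have "AE \<omega> in M. x + (\<Sum>i=1..Suc n. a i \<omega> * v i) \<in> B \<longleftrightarrow> \<omega> \<in> E (-1) \<union> E 1"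
    by (rule AE_mp) (auto intro!: AE_I2 simp: E_def algebra_simps)
  then have "prob {\<omega> \<in> space M. x + (\<Sum>i=1..Suc n. a i \<omega> * v i) \<in> B} = prob (E (-1) \<union> E 1)"
    using assms(3) by (intro finite_measure_eq_AE) auto
  also have "\<dots> = prob (E (-1)) + prob (E 1)"
  proof (rule finite_measure_Union)
    show "E (-1) \<inter> E 1 = {}"
      by (auto simp: E_def)
  qed auto
  finally show ?case
    by (simp add: E)
qed

theorem mainTheorem2:
  fixes M :: "'a measure" and a :: "nat \<Rightarrow> 'a \<Rightarrow> real" and v :: "nat \<Rightarrow> real" and n :: nat
  assumes "prob_space M"
    and "(\<Sum>i=1..n. (v i)\<^sup>2) \<le> 1"
    and "\<And>i. i \<in> {1..n} \<Longrightarrow> random_sign M (a i)"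
    and "prob_space.indep_vars M (\<lambda>_. borel) a {1..n}"
  shows "measure M {\<omega> \<in> space M. \<bar>\<Sum>i=1..n. a i \<omega> * v i\<bar> \<le> 1} > 13 / 32 + 9 * 10 powi (-6)"
proof -
  interpret prob_space M by fact
  let ?vs = "map v (rev [1..<Suc n])"
  have "sumsq ?vs = (\<Sum>i\<leftarrow>[1..<Suc n]. (v i)\<^sup>2)"
    by (simp only: map_map comp_def rev_map[symmetric] sum_list_rev)
  also have "\<dots> = (\<Sum>i=1..n. (v i)\<^sup>2)"
    by (simp only: sum_list_distinct_conv_sum_set distinct_upt set_upt atLeastLessThanSuc_atLeastAtMost)
  finally have "4063 / 10000 \<le> sign_avg unit_ind ?vs 0"
    using assms(2) by (intro sign_avg_unit_ge) simp
  also have "unit_ind = (\<lambda>y. of_bool (y \<in> {-1..1}))"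
    by (auto simp: unit_ind_def fun_eq_iff)
  also have "sign_avg \<dots> ?vs 0 = prob {\<omega> \<in> space M. 0 + (\<Sum>i=1..n. a i \<omega> * v i) \<in> {-1..1}}"
    using assms(3,4) by (intro prob_signed_sum[symmetric]) auto
  also have "{\<omega> \<in> space M. 0 + (\<Sum>i=1..n. a i \<omega> * v i) \<in> {-1..1}}
      = {\<omega> \<in> space M. \<bar>\<Sum>i=1..n. a i \<omega> * v i\<bar> \<le> 1}"
    by (auto simp: abs_le_iff)
  moreover have "13 / 32 + 9 * 10 powi (-6) < (4063 / 10000 :: real)"
    by (simp add: power_int_minus)
  ultimately show ?thesis
    by simp
qed

end
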